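(* A contact configuration of $23$ directions whose cell has circumradius below $2$ meets every root system in at most $20$ directions.
   Context: A contact configuration is a finite set $W\subset S^3\subset\mathbb{R}^4$ of unit vectors (directions) with $\langle w,w'\rangle\le\frac12$ for all distinct $w,w'\in W$. Its cell is $V_c(W)=\{x\in\mathbb{R}^4:\langle x,w\rangle\le1\text{ for all }w\in W\}$, and the circumradius of the cell is $\sup\{|x|:x\in V_c(W)\}$. Here a root system means the image under an orthogonal map of $\mathbb{R}^4$ of the set of $24$ normalised $D_4$ roots $(\pm e_i\pm e_j)/\sqrt2$, $1\le i<j\le4$. *)

theory Defs
  imports "HOL-Analysis.Analysis"
begin

definition contact_configuration :: "(real^4) set \<Rightarrow> bool" where
  "contact_configuration W \<longleftrightarrow>
     finite W \<and> (\<forall>w\<in>W. norm w = 1) \<and>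
     (\<forall>w\<in>W. \<forall>w'\<in>W. w \<noteq> w' \<longrightarrow> w \<bullet> w' \<le> 1/2)"

definition cell :: "(real^4) set \<Rightarrow> (real^4) set" where
  "cell W = {x. \<forall>w\<in>W. x \<bullet> w \<le> 1}"

text \<open>The supremum is taken in the extended reals, since a cell may be unbounded; its
  circumradius is then \<open>\<infinity>\<close>.  (A supremum in \<open>real\<close> would be unspecified there.)\<close>

definition cell_circumradius :: "(real^4) set \<Rightarrow> ereal" where
  "cell_circumradius W = (SUP x\<in>cell W. ereal (norm x))"

text \<open>The four elements of the index type \<open>4\<close> are linearly ordered, so \<open>i < j\<close> ranges over the
  six unordered pairs of coordinates.\<close>

definition D4_roots :: "(real^4) set" where
  "D4_roots = {(s *\<^sub>R axis i 1 + t *\<^sub>R axis j 1) /\<^sub>R sqrt 2 | s t i j.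
                 s \<in> {-1, 1} \<and> t \<in> {-1, 1} \<and> i < j}"

definition root_system :: "(real^4) set \<Rightarrow> bool" where
  "root_system R \<longleftrightarrow> (\<exists>f. orthogonal_transformation f \<and> R = f ` D4_roots)"

end

theory Submission
  imports Defs
begin

text \<open>Suppose \<open>W\<close> omits at most three roots of \<open>R\<close>.  A direction of \<open>W\<close> outside \<open>R\<close> has inner
  product above \<open>1/2\<close> with at least three roots, and all of these must be omitted.  If \<open>W\<close>
  is contained in \<open>R\<close>, it omits a single root \<open>r\<close>, and \<open>2 *\<^sub>R r\<close> lies in the cell.
  Otherwise exactly three roots are omitted and \<open>W\<close> has exactly two directions outside \<open>R\<close>;
  both lie in the region cut out by the same triple of roots, where any two unit vectors have
  inner product above \<open>1/2\<close>.\<close>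

section \<open>Two estimates for real quadruples\<close>

text \<open>Here \<open>a\<close>, \<open>b\<close>, \<open>c\<close>, \<open>d\<close> stand for
  the coordinates of a unit vector scaled by \<open>sqrt 2\<close>, and the quadruple excluded by
  \<open>ne\<close> is a root. If \<open>a + c\<close> were at most 1, then
  \<open>c\<^sup>2 \<le> (1 - a) * a\<close>, and the ordering bounds the sum of squares by
  \<open>2 * a\<close>, which forces the excluded quadruple. If \<open>b + c\<close> and
  \<open>a + d\<close> were both at most 1, the bounds \<open>c\<^sup>2 \<le> (1 - b) * b\<close>
  and \<open>d\<^sup>2 \<le> (1 - a) * a\<close> would give \<open>2 \<le> a + b\<close>, with the
  same outcome.\<close>

lemma sorted_quadruple_pair_sums:
  fixes a b c d :: real
  assumes ord: "a \<ge> b" "b \<ge> c" "c \<ge> d" "d \<ge> 0"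
    and sq: "a\<^sup>2 + b\<^sup>2 + c\<^sup>2 + d\<^sup>2 = 2"
    and ne: "\<not> (a = 1 \<and> b = 1 \<and> c = 0 \<and> d = 0)"
  shows "a + b > 1" "a + c > 1" "b + c > 1 \<or> a + d > 1"
proof -
  have d2: "d\<^sup>2 \<le> c\<^sup>2" "b\<^sup>2 \<le> a\<^sup>2" "c\<^sup>2 \<le> b\<^sup>2"
    using ord by (auto intro!: power_mono)
  show ac: "a + c > 1"
  proof (rule ccontr)
    assume "\<not> ?thesis"
    then have "c \<le> 1 - a" by simp
    then have a1: "a \<le> 1" and c2: "c * c \<le> (1 - a) * c"
      using ord by (simp, intro mult_right_mono) auto
    have "c\<^sup>2 \<le> (1 - a) * a"
      using c2 mult_left_mono[of c a "1 - a"] ord a1 by (simp add: power2_eq_square)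
    then have "2 \<le> 2 * a"
      using sq d2 by (simp add: power2_eq_square algebra_simps)
    then have "a = 1" using a1 by simp
    moreover from this have "c = 0" "d = 0" using \<open>c \<le> 1 - a\<close> ord by auto
    moreover from calculation have "b\<^sup>2 = 1" using sq by simp
    then have "b = 1" using ord by (simp add: power2_eq_1_iff)
    ultimately show False using ne by simp
  qed
  then show "a + b > 1" using ord by simp
  show "b + c > 1 \<or> a + d > 1"
  proof (rule ccontr)
    assume "\<not> ?thesis"
    then have bc: "c \<le> 1 - b" and ad: "d \<le> 1 - a" by auto
    then have le1: "a \<le> 1" "b \<le> 1" using ord by auto
    have "c * c \<le> (1 - b) * b" using bc ord by (intro mult_mono) auto
    moreover have "d * d \<le> (1 - a) * a" using ad ord by (intro mult_mono) auto
    ultimately have "2 \<le> a + b" using sq by (simp add: power2_eq_square algebra_simps)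
    then have "a = 1" "b = 1" using le1 by auto
    then show False using ne bc ad ord by auto
  qed
qed

text \<open>Each of \<open>x\<close>, \<open>y\<close>, \<open>z\<close> lies between 0 and
  \<open>1 - p\<close>, so its square is at most \<open>1 - p\<close> times itself. Adding these
  gives \<open>2 - p\<^sup>2 \<le> (1 - p) * (x + y + z)\<close>; the left side is at least
  \<open>(1 - p) * (2 + 2 * p)\<close>, and the positive factor \<open>1 - p\<close>
  cancels.\<close>

lemma sum3_ge_of_sumsq_eq_2:
  fixes x y z p :: real
  assumes nn: "x \<ge> 0" "y \<ge> 0" "z \<ge> 0" "p \<ge> 0"
    and le: "x + p \<le> 1" "y + p \<le> 1" "z + p \<le> 1"
    and sq: "x\<^sup>2 + y\<^sup>2 + z\<^sup>2 + p\<^sup>2 = 2"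
  shows "x + y + z \<ge> 2 + 2 * p"
proof -
  have *: "u\<^sup>2 \<le> (1 - p) * u" if "u \<ge> 0" "u + p \<le> 1" for u
    using that mult_right_mono[of u "1 - p" u] by (simp add: power2_eq_square)
  have p1: "p < 1"
  proof (rule ccontr)
    assume "\<not> p < 1"
    then have "p = 1" "x = 0" "y = 0" "z = 0" using nn le by auto
    then show False using sq by simp
  qed
  have "2 - p\<^sup>2 \<le> (1 - p) * (x + y + z)"
    using *[of x] *[of y] *[of z] nn le sq by (simp add: algebra_simps)
  moreover have "(1 - p) * (2 + 2 * p) \<le> 2 - p\<^sup>2"
    by (simp add: algebra_simps power2_eq_square)
  ultimately have "(1 - p) * (2 + 2 * p) \<le> (1 - p) * (x + y + z)" by linarith
  then show ?thesis using p1 by simp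
qed

text \<open>With \<open>p = \<bar>u\<bar>\<close> and \<open>q = \<bar>u'\<bar>\<close>, write
  \<open>x = (1 - p) - (1 - p - x)\<close>, and likewise for \<open>y\<close> and \<open>z\<close>.
  The deficits \<open>1 - p - x\<close> are non-negative and \<open>x' \<le> 1 - q\<close>, so the
  inner product is bounded below in terms of the two coordinate sums alone, and these are large by
  \<open>sum3_ge_of_sumsq_eq_2\<close>.\<close>

lemma octant_dot_gt_1:
  fixes x y z u x' y' z' u' :: real
  assumes gt: "x + y > 1" "x + z > 1" "y + z > 1"
    and gt': "x' + y' > 1" "x' + z' > 1" "y' + z' > 1"
    and le: "x + \<bar>u\<bar> \<le> 1" "y + \<bar>u\<bar> \<le> 1" "z + \<bar>u\<bar> \<le> 1"
    and le': "x' + \<bar>u'\<bar> \<le> 1" "y' + \<bar>u'\<bar> \<le> 1" "z' + \<bar>u'\<bar> \<le> 1"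
    and sq: "x\<^sup>2 + y\<^sup>2 + z\<^sup>2 + u\<^sup>2 = 2" and sq': "x'\<^sup>2 + y'\<^sup>2 + z'\<^sup>2 + u'\<^sup>2 = 2"
  shows "x * x' + y * y' + z * z' + u * u' > 1"
proof -
  define p q where "p = \<bar>u\<bar>" and "q = \<bar>u'\<bar>"
  have pq: "p \<ge> 0" "q \<ge> 0" by (auto simp: p_def q_def)
  have pos: "x > 0" "y > 0" "z > 0" "x' > 0" "y' > 0" "z' > 0"
    using gt gt' le le' by auto
  note le = le[folded p_def] and le' = le'[folded q_def]
  have S: "x + y + z \<ge> 2 + 2 * p"
    by (rule sum3_ge_of_sumsq_eq_2) (use pos pq le sq in \<open>auto simp: p_def\<close>)
  have S': "x' + y' + z' \<ge> 2 + 2 * q"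
    by (rule sum3_ge_of_sumsq_eq_2) (use pos pq le' sq' in \<open>auto simp: q_def\<close>)
  \<comment> \<open>The sum \<open>x + y + z\<close> lies between \<open>2 + 2 * p\<close> and
    \<open>3 - 3 * p\<close>. The resulting bound on \<open>p\<close> later makes
    \<open>8 * (p * q)\<close> smaller than \<open>3 * p + 3 * q\<close> unless both vanish.\<close>
  have p5: "5 * p \<le> 1" and q5: "5 * q \<le> 1" using S S' le le' by linarith+
  have uu: "u * u' \<ge> - (p * q)"
    by (metis abs_ge_minus_self abs_mult minus_le_iff p_def q_def)
  have gap: "(1 - p - t) * t' \<le> (1 - p - t) * (1 - q)" if "t + p \<le> 1" "t' + q \<le> 1" for t t' :: real
    using that by (intro mult_left_mono) auto
  have dot: "x * x' + y * y' + z * z' \<ge> (1 - p) * (x' + y' + z') - (1 - q) * (3 - 3 * p - (x + y + z))"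
    using gap[of x x'] gap[of y y'] gap[of z z'] le le' by (simp add: algebra_simps)
  show ?thesis
  proof (cases "p = 0 \<and> q = 0")
    case False
    have "(1 - p) * (x' + y' + z') \<ge> (1 - p) * (2 + 2 * q)"
      using S' p5 pq by (intro mult_left_mono) auto
    moreover have "(1 - q) * (3 - 3 * p - (x + y + z)) \<le> (1 - q) * (1 - 5 * p)"
      using S q5 pq by (intro mult_left_mono) auto
    ultimately have "x * x' + y * y' + z * z' + u * u' \<ge> 1 + 3 * p + 3 * q - 8 * (p * q)"
      using dot uu by (simp add: algebra_simps)
    moreover have "5 * (p * q) \<le> q"
      using mult_right_mono[OF p5, of q] pq by (simp add: algebra_simps)
    ultimately show ?thesis using False pq by linarith
  next
    case True
    \<comment> \<open>The general bound gives only \<open>\<ge> 1\<close> here, so strictness must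
      come from elsewhere: if the sum were at most 2, positive coordinates bounded by 1 with squares
      adding to 2 would all equal 1, and the squares would add to 3.\<close>
    have "x + y + z > 2"
    proof (rule ccontr)
      assume "\<not> ?thesis"
      moreover have "x * x \<le> x" "y * y \<le> y" "z * z \<le> z"
        using le pos True by (simp_all add: mult_left_le)
      moreover have "x * x + y * y + z * z = 2"
        using sq True p_def by (simp add: power2_eq_square)
      ultimately have "x * x = x" "y * y = y" "z * z = z" by linarith+
      then have "x = 1" "y = 1" "z = 1" using pos by auto
      then show False using \<open>x * x + y * y + z * z = 2\<close> by simp
    qed
    then show ?thesis using dot S' uu True by simp
  qed
qed

section \<open>Frames of a root system\<close>

text \<open>The vectors \<open>sqrt 2 *\<^sub>R r\<close>, for \<open>r\<close> in a root system, are exactly the integer vectors of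
  squared length 2 in a suitable orthonormal basis.\<close>

definition root_frame :: "(real^4) set \<Rightarrow> real^4 \<Rightarrow> real^4 \<Rightarrow> real^4 \<Rightarrow> real^4 \<Rightarrow> bool" where
  "root_frame R a b c d \<longleftrightarrow>
     a \<bullet> a = 1 \<and> b \<bullet> b = 1 \<and> c \<bullet> c = 1 \<and> d \<bullet> d = 1 \<and>
     a \<bullet> b = 0 \<and> a \<bullet> c = 0 \<and> a \<bullet> d = 0 \<and> b \<bullet> c = 0 \<and> b \<bullet> d = 0 \<and> c \<bullet> d = 0 \<and>
     (\<forall>v. v = (v \<bullet> a) *\<^sub>R a + (v \<bullet> b) *\<^sub>R b + (v \<bullet> c) *\<^sub>R c + (v \<bullet> d) *\<^sub>R d) \<and>
     (\<forall>p q r s :: int. p\<^sup>2 + q\<^sup>2 + r\<^sup>2 + s\<^sup>2 = 2 \<longrightarrow>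
        (of_int p *\<^sub>R a + of_int q *\<^sub>R b + of_int r *\<^sub>R c + of_int s *\<^sub>R d) /\<^sub>R sqrt 2 \<in> R)"

lemma root_frame_inner:
  assumes "root_frame R a b c d"
  shows "v \<bullet> w = (v \<bullet> a) * (w \<bullet> a) + (v \<bullet> b) * (w \<bullet> b) + (v \<bullet> c) * (w \<bullet> c) + (v \<bullet> d) * (w \<bullet> d)"
proof -
  have "v = (v \<bullet> a) *\<^sub>R a + (v \<bullet> b) *\<^sub>R b + (v \<bullet> c) *\<^sub>R c + (v \<bullet> d) *\<^sub>R d"
    using assms by (simp only: root_frame_def)
  then have "v \<bullet> w = ((v \<bullet> a) *\<^sub>R a + (v \<bullet> b) *\<^sub>R b + (v \<bullet> c) *\<^sub>R c + (v \<bullet> d) *\<^sub>R d) \<bullet> w" by metis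
  then show ?thesis by (simp add: inner_add_left inner_add_right inner_commute mult.commute)
qed

lemma root_frame_root:
  assumes "root_frame R a b c d" "p\<^sup>2 + q\<^sup>2 + r\<^sup>2 + s\<^sup>2 = 2"
  shows "(of_int p *\<^sub>R a + of_int q *\<^sub>R b + of_int r *\<^sub>R c + of_int s *\<^sub>R d) /\<^sub>R sqrt 2 \<in> R"
  using assms by (simp add: root_frame_def)

lemma root_frame_expansion:
  assumes "root_frame R a b c d"
  shows "v = (v \<bullet> a) *\<^sub>R a + (v \<bullet> b) *\<^sub>R b + (v \<bullet> c) *\<^sub>R c + (v \<bullet> d) *\<^sub>R d"
  using assms by (simp only: root_frame_def)

section \<open>Changes of frame: transpositions, a sign change and triality\<close>

lemma root_frame_swap12:
  assumes "root_frame R a b c d"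
  shows "root_frame R b a c d"
proof -
  have "v = (v \<bullet> b) *\<^sub>R b + (v \<bullet> a) *\<^sub>R a + (v \<bullet> c) *\<^sub>R c + (v \<bullet> d) *\<^sub>R d" for v
    using root_frame_expansion[OF assms, of v] by (simp add: algebra_simps)
  moreover have "(of_int p *\<^sub>R b + of_int q *\<^sub>R a + of_int r *\<^sub>R c + of_int s *\<^sub>R d) /\<^sub>R sqrt 2 \<in> R"
    if "p\<^sup>2 + q\<^sup>2 + r\<^sup>2 + s\<^sup>2 = 2" for p q r s :: int
    using root_frame_root[OF assms, of q p r s] that by (simp add: algebra_simps)
  ultimately show ?thesis using assms unfolding root_frame_def by (simp add: inner_commute)
qed

lemma root_frame_swap23:
  assumes "root_frame R a b c d"
  shows "root_frame R a c b d"
proof -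
  have "v = (v \<bullet> a) *\<^sub>R a + (v \<bullet> c) *\<^sub>R c + (v \<bullet> b) *\<^sub>R b + (v \<bullet> d) *\<^sub>R d" for v
    using root_frame_expansion[OF assms, of v] by (simp add: algebra_simps)
  moreover have "(of_int p *\<^sub>R a + of_int q *\<^sub>R c + of_int r *\<^sub>R b + of_int s *\<^sub>R d) /\<^sub>R sqrt 2 \<in> R"
    if "p\<^sup>2 + q\<^sup>2 + r\<^sup>2 + s\<^sup>2 = 2" for p q r s :: int
    using root_frame_root[OF assms, of p r q s] that by (simp add: algebra_simps)
  ultimately show ?thesis using assms unfolding root_frame_def by (simp add: inner_commute)
qed

lemma root_frame_swap34:
  assumes "root_frame R a b c d"
  shows "root_frame R a b d c"
proof -
  have "v = (v \<bullet> a) *\<^sub>R a + (v \<bullet> b) *\<^sub>R b + (v \<bullet> d) *\<^sub>R d + (v \<bullet> c) *\<^sub>R c" for v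
    using root_frame_expansion[OF assms, of v] by (simp add: algebra_simps)
  moreover have "(of_int p *\<^sub>R a + of_int q *\<^sub>R b + of_int r *\<^sub>R d + of_int s *\<^sub>R c) /\<^sub>R sqrt 2 \<in> R"
    if "p\<^sup>2 + q\<^sup>2 + r\<^sup>2 + s\<^sup>2 = 2" for p q r s :: int
    using root_frame_root[OF assms, of p q s r] that by (simp add: algebra_simps)
  ultimately show ?thesis using assms unfolding root_frame_def by (simp add: inner_commute)
qed

lemma root_frame_uminus:
  assumes "root_frame R a b c d"
  shows "root_frame R (- a) b c d"
proof -
  have "v = (v \<bullet> - a) *\<^sub>R - a + (v \<bullet> b) *\<^sub>R b + (v \<bullet> c) *\<^sub>R c + (v \<bullet> d) *\<^sub>R d" for v
    using root_frame_expansion[OF assms, of v] by simp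
  moreover have "(of_int p *\<^sub>R - a + of_int q *\<^sub>R b + of_int r *\<^sub>R c + of_int s *\<^sub>R d) /\<^sub>R sqrt 2 \<in> R"
    if "p\<^sup>2 + q\<^sup>2 + r\<^sup>2 + s\<^sup>2 = 2" for p q r s :: int
    using root_frame_root[OF assms, of "- p" q r s] that by (simp add: algebra_simps)
  ultimately show ?thesis using assms unfolding root_frame_def by simp
qed

text \<open>This change of frame is not a signed permutation: it comes from the triality symmetry of
  \<open>D\<^sub>4\<close>.  It preserves the integer vectors of squared length 2 because their coordinate sum is
  even.\<close>

lemma root_frame_half_sums:
  assumes "root_frame R a b c d"
  shows "root_frame R ((a + b + c - d) /\<^sub>R 2) ((a + b - c + d) /\<^sub>R 2)
           ((a - b + c + d) /\<^sub>R 2) ((a - b - c - d) /\<^sub>R 2)"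
proof -
  let ?a = "(a + b + c - d) /\<^sub>R 2" and ?b = "(a + b - c + d) /\<^sub>R 2"
  let ?c = "(a - b + c + d) /\<^sub>R 2" and ?d = "(a - b - c - d) /\<^sub>R 2"
  have "v = (v \<bullet> ?a) *\<^sub>R ?a + (v \<bullet> ?b) *\<^sub>R ?b + (v \<bullet> ?c) *\<^sub>R ?c + (v \<bullet> ?d) *\<^sub>R ?d" for v
  proof -
    have "(v \<bullet> ?a) *\<^sub>R ?a + (v \<bullet> ?b) *\<^sub>R ?b + (v \<bullet> ?c) *\<^sub>R ?c + (v \<bullet> ?d) *\<^sub>R ?d
      = (v \<bullet> a) *\<^sub>R a + (v \<bullet> b) *\<^sub>R b + (v \<bullet> c) *\<^sub>R c + (v \<bullet> d) *\<^sub>R d"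
      by (simp add: vec_eq_iff inner_add_right inner_diff_right field_simps)
    then show ?thesis using root_frame_expansion[OF assms, of v] by simp
  qed
  moreover have "(of_int p *\<^sub>R ?a + of_int q *\<^sub>R ?b + of_int r *\<^sub>R ?c + of_int s *\<^sub>R ?d) /\<^sub>R sqrt 2 \<in> R"
    if sq: "p\<^sup>2 + q\<^sup>2 + r\<^sup>2 + s\<^sup>2 = 2" for p q r s :: int
  proof -
    have "even (p\<^sup>2 + q\<^sup>2 + r\<^sup>2 + s\<^sup>2)" using sq by simp
    then have "even (p + q + r + s)" by simp
    then obtain h where "p + q + r + s = 2 * h" by (elim evenE)
    then have h: "p = 2 * h - q - r - s" by linarith
    \<comment> \<open>The coefficients in the old frame are half sums such as
      \<open>(p + q - r - s) / 2\<close>, rewritten through \<open>h\<close> so as to be visibly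
      integers.\<close>
    let ?v = "of_int h *\<^sub>R a + of_int (h - r - s) *\<^sub>R b + of_int (h - q - s) *\<^sub>R c
                + of_int (q + r - h) *\<^sub>R d"
    have "of_int p *\<^sub>R ?a + of_int q *\<^sub>R ?b + of_int r *\<^sub>R ?c + of_int s *\<^sub>R ?d = ?v"
      by (simp add: h vec_eq_iff field_simps)
    moreover have "h\<^sup>2 + (h - r - s)\<^sup>2 + (h - q - s)\<^sup>2 + (q + r - h)\<^sup>2 = 2"
      using sq unfolding h power2_eq_square by (simp add: algebra_simps)
    ultimately show ?thesis using root_frame_root[OF assms, of h "h - r - s" "h - q - s" "q + r - h"]
      by simp
  qed
  ultimately show ?thesis using assms unfolding root_frame_def
    by (simp add: inner_add_left inner_add_right inner_diff_left inner_diff_right inner_commute)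
qed

lemma root_frame_nonneg:
  assumes "root_frame R a b c d"
  obtains a' b' c' d' where "root_frame R a' b' c' d'"
    "w \<bullet> a' \<ge> 0" "w \<bullet> b' \<ge> 0" "w \<bullet> c' \<ge> 0" "w \<bullet> d' \<ge> 0"
proof -
  let ?s = "\<lambda>x. if w \<bullet> x \<ge> 0 then x else - x"
  \<comment> \<open>Correcting the first axis and rotating it to the end means that four repetitions
    treat every axis and restore the order.\<close>
  have step: "root_frame R b c d (?s a)" if "root_frame R a b c d" for a b c d
  proof -
    have "root_frame R (?s a) b c d"
      using that root_frame_uminus[OF that] by simp
    then show ?thesis
      by (rule root_frame_swap34[OF root_frame_swap23[OF root_frame_swap12]])
  qed
  have "root_frame R (?s a) (?s b) (?s c) (?s d)"
    by (rule step[OF step[OF step[OF step[OF assms]]]])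
  then show ?thesis by (rule that) auto
qed

text \<open>The predicate is arbitrary so that sorting can carry the signs of the coordinates along
  with the frame. Both halves are sorted, the half with the larger maximum is moved to the front,
  and the remaining entry \<open>b2\<close> is merged into \<open>c2\<close>,
  \<open>d2\<close>.\<close>

lemma obtain_sorted_quadruple:
  fixes g :: "'a \<Rightarrow> real"
  assumes s12: "\<And>a b c d. P a b c d \<Longrightarrow> P b a c d"
    and s23: "\<And>a b c d. P a b c d \<Longrightarrow> P a c b d"
    and s34: "\<And>a b c d. P a b c d \<Longrightarrow> P a b d c"
    and "P a b c d"
  obtains a' b' c' d' where "P a' b' c' d'" "g a' \<ge> g b'" "g b' \<ge> g c'" "g c' \<ge> g d'"
proof -
  have s13: "P c b a d" if "P a b c d" for a b c d using that s12 s23 by blast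
  have s24: "P a d c b" if "P a b c d" for a b c d using that s34 s23 by blast
  obtain a1 b1 where 1: "P a1 b1 c d" "g a1 \<ge> g b1"
    using assms(4) s12[OF assms(4)] by (cases "g a \<ge> g b") auto
  obtain c1 d1 where 2: "P a1 b1 c1 d1" "g c1 \<ge> g d1"
    using 1(1) s34[OF 1(1)] by (cases "g c \<ge> g d") auto
  have "\<exists>a2 b2 c2 d2. P a2 b2 c2 d2 \<and> g a2 \<ge> g b2 \<and> g c2 \<ge> g d2 \<and> g a2 \<ge> g c2"
  proof (cases "g a1 \<ge> g c1")
    case False
    have "P c1 d1 a1 b1" by (rule s13[OF s24[OF 2(1)]])
    then show ?thesis using False 1 2 by (intro exI[of _ c1] exI[of _ d1] exI[of _ a1] exI[of _ b1]) auto
  qed (use 1 2 in blast)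
  then obtain a2 b2 c2 d2 where 3: "P a2 b2 c2 d2" "g a2 \<ge> g b2" "g c2 \<ge> g d2" "g a2 \<ge> g c2"
    by blast
  consider "g b2 \<ge> g c2" | "g c2 \<ge> g b2" "g b2 \<ge> g d2" | "g d2 \<ge> g b2" by linarith
  then show ?thesis
  proof cases
    case 1
    then show ?thesis using that 3 by blast
  next
    case 2
    then show ?thesis using that[OF s23[OF 3(1)]] 3 by auto
  next
    case 3
    then show ?thesis using that[OF s34[OF s23[OF \<open>P a2 b2 c2 d2\<close>]]] \<open>g c2 \<ge> g d2\<close> \<open>g a2 \<ge> g c2\<close>
      by auto
  qed
qed

section \<open>Roots close to a given unit vector\<close>

lemma root_frame_pair_root:
  assumes "root_frame R a b c d" "s \<in> {-1, 1}" "t \<in> {-1, 1}"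
    and "(x, y) \<in> {(a, b), (a, c), (a, d), (b, c), (b, d), (c, d)}"
  shows "(s *\<^sub>R x + t *\<^sub>R y) /\<^sub>R sqrt 2 \<in> R"
proof -
  obtain p q :: int where pq: "s = of_int p" "t = of_int q" "p\<^sup>2 = 1" "q\<^sup>2 = 1"
    using assms(2,3) by (metis insertE of_int_1 of_int_minus one_power2 power2_minus singletonD)
  show ?thesis
    using assms(4) pq root_frame_root[OF assms(1), of p q 0 0]
      root_frame_root[OF assms(1), of p 0 q 0] root_frame_root[OF assms(1), of p 0 0 q]
      root_frame_root[OF assms(1), of 0 p q 0] root_frame_root[OF assms(1), of 0 p 0 q]
      root_frame_root[OF assms(1), of 0 0 p q] by auto
qed

text \<open>This translates the threshold \<open>1/2\<close> for inner products with roots into the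
  threshold 1 for pair sums of scaled coordinates.\<close>

lemma inner_scaled_sum_gt_half_iff:
  fixes w x y :: "'a::real_inner"
  shows "w \<bullet> ((x + y) /\<^sub>R sqrt 2) > 1/2 \<longleftrightarrow> sqrt 2 * (w \<bullet> x) + sqrt 2 * (w \<bullet> y) > 1"
proof -
  have "w \<bullet> ((x + y) /\<^sub>R sqrt 2) = (sqrt 2 * (w \<bullet> x) + sqrt 2 * (w \<bullet> y)) / 2"
    by (simp add: inner_add_right field_simps)
  then show ?thesis by simp
qed

lemma root_frame_sumsq:
  assumes "root_frame R a b c d" "norm w = 1"
  shows "(sqrt 2 * (w \<bullet> a))\<^sup>2 + (sqrt 2 * (w \<bullet> b))\<^sup>2 + (sqrt 2 * (w \<bullet> c))\<^sup>2 + (sqrt 2 * (w \<bullet> d))\<^sup>2 = 2"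
proof -
  have "w \<bullet> w = 1" using assms(2) by (simp add: dot_square_norm)
  then show ?thesis using root_frame_inner[OF assms(1), of w w]
    by (simp add: power_mult_distrib flip: power2_eq_square)
qed

text \<open>In a frame where the coordinates of \<open>w\<close> are non-negative and decreasing,
  \<open>sorted_quadruple_pair_sums\<close> yields three close roots. They come either from the
  pairs among the first three axes or from the pairs containing the first axis; triality turns the
  second pattern into the first, so a single shape remains.\<close>

lemma non_root_frame:
  assumes "root_frame R a b c d" "norm w = 1" "w \<notin> R"
  obtains a' b' c' d' where "root_frame R a' b' c' d'"
    "w \<bullet> ((a' + b') /\<^sub>R sqrt 2) > 1/2" "w \<bullet> ((a' + c') /\<^sub>R sqrt 2) > 1/2"
    "w \<bullet> ((b' + c') /\<^sub>R sqrt 2) > 1/2"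
proof -
  let ?P = "\<lambda>a b c d. root_frame R a b c d \<and> w \<bullet> a \<ge> 0 \<and> w \<bullet> b \<ge> 0 \<and> w \<bullet> c \<ge> 0 \<and> w \<bullet> d \<ge> 0"
  obtain a0 b0 c0 d0 where "?P a0 b0 c0 d0"
    by (rule root_frame_nonneg[OF assms(1), of w]) simp
  then obtain a1 b1 c1 d1 where P: "?P a1 b1 c1 d1"
    and ord: "w \<bullet> a1 \<ge> w \<bullet> b1" "w \<bullet> b1 \<ge> w \<bullet> c1" "w \<bullet> c1 \<ge> w \<bullet> d1"
    by (rule obtain_sorted_quadruple[of ?P a0 b0 c0 d0 "\<lambda>x. w \<bullet> x", rotated 3])
      (auto intro: root_frame_swap12 root_frame_swap23 root_frame_swap34)
  then have fr: "root_frame R a1 b1 c1 d1" and d0: "w \<bullet> d1 \<ge> 0" by auto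
  have ne: "\<not> (sqrt 2 * (w \<bullet> a1) = 1 \<and> sqrt 2 * (w \<bullet> b1) = 1 \<and> sqrt 2 * (w \<bullet> c1) = 0 \<and> sqrt 2 * (w \<bullet> d1) = 0)"
  proof
    assume h: "sqrt 2 * (w \<bullet> a1) = 1 \<and> sqrt 2 * (w \<bullet> b1) = 1 \<and> sqrt 2 * (w \<bullet> c1) = 0 \<and> sqrt 2 * (w \<bullet> d1) = 0"
    then have e: "w \<bullet> a1 = inverse (sqrt 2)" "w \<bullet> b1 = inverse (sqrt 2)" "w \<bullet> c1 = 0" "w \<bullet> d1 = 0"
      by (auto simp: field_simps)
    have "w = (a1 + b1) /\<^sub>R sqrt 2"
      using root_frame_expansion[OF fr, of w] unfolding e by (simp add: scaleR_add_right)
    moreover have "(a1 + b1) /\<^sub>R sqrt 2 \<in> R"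
      using root_frame_pair_root[OF fr, of 1 1 a1 b1] by simp
    ultimately show False using assms(3) by simp
  qed
  note sums = sorted_quadruple_pair_sums[OF _ _ _ _ root_frame_sumsq[OF fr assms(2)] ne]
  have 1: "sqrt 2 * (w \<bullet> a1) + sqrt 2 * (w \<bullet> b1) > 1" "sqrt 2 * (w \<bullet> a1) + sqrt 2 * (w \<bullet> c1) > 1"
    and 2: "sqrt 2 * (w \<bullet> b1) + sqrt 2 * (w \<bullet> c1) > 1 \<or> sqrt 2 * (w \<bullet> a1) + sqrt 2 * (w \<bullet> d1) > 1"
    by (rule sums; use ord d0 in simp)+
  from 2 show ?thesis
  proof
    assume "sqrt 2 * (w \<bullet> b1) + sqrt 2 * (w \<bullet> c1) > 1"
    then show ?thesis using that[OF fr] 1 unfolding inner_scaled_sum_gt_half_iff by blast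
  next
    assume 3: "sqrt 2 * (w \<bullet> a1) + sqrt 2 * (w \<bullet> d1) > 1"
    \<comment> \<open>The pair sums of the first three axes of the half-sum frame are exactly the
      sums of \<open>a1\<close> with the other old axes.\<close>
    have e: "(a1 + b1 + c1 - d1) /\<^sub>R 2 + (a1 + b1 - c1 + d1) /\<^sub>R 2 = a1 + b1"
      "(a1 + b1 + c1 - d1) /\<^sub>R 2 + (a1 - b1 + c1 + d1) /\<^sub>R 2 = a1 + c1"
      "(a1 + b1 - c1 + d1) /\<^sub>R 2 + (a1 - b1 + c1 + d1) /\<^sub>R 2 = a1 + d1"
      by (simp_all add: vec_eq_iff field_simps)
    show ?thesis
      by (rule that[OF root_frame_half_sums[OF fr]]; unfold e inner_scaled_sum_gt_half_iff; fact 1 3)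
  qed
qed

text \<open>The roots built from \<open>d\<close> and one of \<open>a\<close>, \<open>b\<close>,
  \<open>c\<close> lie outside the triple, so \<open>le\<close> applies to them for both signs of
  \<open>d\<close> and bounds each scaled coordinate plus the absolute value of the scaled
  \<open>d\<close>-coordinate by 1. Together with \<open>gt\<close> these are the hypotheses of
  \<open>octant_dot_gt_1\<close>.\<close>

lemma root_frame_inner_gt_half:
  assumes fr: "root_frame R a b c d"
    and gt: "\<And>w r. w \<in> {v, v'} \<Longrightarrow>
      r \<in> {(a + b) /\<^sub>R sqrt 2, (a + c) /\<^sub>R sqrt 2, (b + c) /\<^sub>R sqrt 2} \<Longrightarrow> w \<bullet> r > 1/2"
    and le: "\<And>w r. w \<in> {v, v'} \<Longrightarrow> r \<in> R \<Longrightarrow>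
      r \<notin> {(a + b) /\<^sub>R sqrt 2, (a + c) /\<^sub>R sqrt 2, (b + c) /\<^sub>R sqrt 2} \<Longrightarrow> w \<bullet> r \<le> 1/2"
    and norm: "norm v = 1" "norm v' = 1"
  shows "v \<bullet> v' > 1/2"
proof -
  have d: "d \<bullet> r = 0" if "r \<in> {(a + b) /\<^sub>R sqrt 2, (a + c) /\<^sub>R sqrt 2, (b + c) /\<^sub>R sqrt 2}" for r
    using that fr by (auto simp: root_frame_def inner_add_right inner_commute)
  have abs: "sqrt 2 * (w \<bullet> x) + \<bar>sqrt 2 * (w \<bullet> d)\<bar> \<le> 1" if w: "w \<in> {v, v'}" and x: "x \<in> {a, b, c}" for w x
  proof -
    have *: "sqrt 2 * (w \<bullet> x) + sqrt 2 * (w \<bullet> (t *\<^sub>R d)) \<le> 1" if t: "t \<in> {-1, 1}" for t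
    proof -
      have "(x + t *\<^sub>R d) /\<^sub>R sqrt 2 \<in> R"
        using root_frame_pair_root[OF fr _ t, of 1 x d] x by auto
      \<comment> \<open>Every member of the triple is orthogonal to \<open>d\<close>, so this
        separates the root from the triple.\<close>
      moreover have "d \<bullet> ((x + t *\<^sub>R d) /\<^sub>R sqrt 2) \<noteq> 0"
        using x t fr by (auto simp: root_frame_def inner_add_right inner_diff_right inner_commute)
      ultimately have "w \<bullet> ((x + t *\<^sub>R d) /\<^sub>R sqrt 2) \<le> 1/2"
        using le[OF w] d by blast
      then show ?thesis using inner_scaled_sum_gt_half_iff[of w x "t *\<^sub>R d"] by linarith
    qed
    show ?thesis using *[of 1] *[of "-1"] by (simp add: abs_if)
  qed
  have pair: "sqrt 2 * (w \<bullet> x) + sqrt 2 * (w \<bullet> y) > 1"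
    if "w \<in> {v, v'}" "(x, y) \<in> {(a, b), (a, c), (b, c)}" for w x y
    using gt[OF that(1), of "(x + y) /\<^sub>R sqrt 2"] that(2) unfolding inner_scaled_sum_gt_half_iff by auto
  have "(sqrt 2 * (v \<bullet> a)) * (sqrt 2 * (v' \<bullet> a)) + (sqrt 2 * (v \<bullet> b)) * (sqrt 2 * (v' \<bullet> b))
      + (sqrt 2 * (v \<bullet> c)) * (sqrt 2 * (v' \<bullet> c)) + (sqrt 2 * (v \<bullet> d)) * (sqrt 2 * (v' \<bullet> d)) > 1"
    by (rule octant_dot_gt_1[OF _ _ _ _ _ _ _ _ _ _ _ _ root_frame_sumsq[OF fr norm(1)]
          root_frame_sumsq[OF fr norm(2)]]) (rule pair abs; simp)+
  moreover have "(sqrt 2 * x) * (sqrt 2 * y) = 2 * (x * y)" for x y :: real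
    by (simp add: mult.assoc mult.left_commute)
  ultimately show ?thesis using root_frame_inner[OF fr, of v v'] by simp
qed

section \<open>The normalised roots\<close>

lemma D4_roots_eq:
  "D4_roots = {(s *\<^sub>R axis i 1 + t *\<^sub>R axis j 1) /\<^sub>R sqrt 2 | s t i j.
                 s \<in> {-1, 1} \<and> t \<in> {-1, 1} \<and> i \<noteq> j}" (is "_ = ?A")
proof (intro equalityI subsetI)
  fix x assume "x \<in> ?A"
  then obtain s t :: real and i j :: 4 where
    h: "x = (s *\<^sub>R axis i 1 + t *\<^sub>R axis j 1) /\<^sub>R sqrt 2" "s \<in> {-1, 1}" "t \<in> {-1, 1}" "i \<noteq> j" by blast
  from h(4) consider "i < j" | "j < i" by (rule linorder_neqE)
  then show "x \<in> D4_roots"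
  proof cases
    case 1
    then show ?thesis unfolding D4_roots_def using h by blast
  next
    case 2
    then show ?thesis unfolding D4_roots_def using h(1-3)
      by (intro CollectI exI[of _ t] exI[of _ s] exI[of _ j] exI[of _ i]) (simp add: add.commute)
  qed
qed (auto simp: D4_roots_def)

lemma D4_roots_norm_coord:
  assumes "x \<in> D4_roots"
  shows "norm x = 1" "sqrt 2 * x $ k \<in> \<int>"
proof -
  obtain s t :: real and i j :: 4 where
    h: "x = (s *\<^sub>R axis i 1 + t *\<^sub>R axis j 1) /\<^sub>R sqrt 2" "s \<in> {-1, 1}" "t \<in> {-1, 1}" "i \<noteq> j"
    using assms unfolding D4_roots_eq by blast
  have "x \<bullet> x = 1" using h
    by (auto simp: inner_add_left inner_add_right inner_diff_left inner_diff_right inner_axis_axis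
        field_simps)
  then show "norm x = 1" by (simp add: norm_eq_1)
  show "sqrt 2 * x $ k \<in> \<int>" using h by (auto simp: axis_def)
qed

text \<open>Scaled by \<open>sqrt 2\<close>, roots are integer vectors, so
  \<open>2 * (x \<bullet> y)\<close> is an integer. It is below 2 by the strict Cauchy-Schwarz
  inequality for distinct unit vectors, hence at most 1.\<close>

lemma D4_roots_inner_le_half:
  assumes "x \<in> D4_roots" "y \<in> D4_roots" "x \<noteq> y"
  shows "x \<bullet> y \<le> 1/2"
proof -
  have n: "norm x = 1" "norm y = 1" using assms D4_roots_norm_coord by auto
  have "x \<bullet> y \<noteq> 1"
    using norm_cauchy_schwarz_eq[of x y] n assms(3) by auto
  then have "x \<bullet> y < 1" using norm_cauchy_schwarz[of x y] n by simp
  have "(sqrt 2 * a) * (sqrt 2 * b) = 2 * (a * b)" for a b :: real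
    by (simp add: mult.assoc mult.left_commute)
  then have "2 * (x \<bullet> y) = (\<Sum>k\<in>UNIV. (sqrt 2 * x $ k) * (sqrt 2 * y $ k))"
    by (simp only: inner_vec_def sum_distrib_left inner_real_def)
  moreover have "(sqrt 2 * x $ k) * (sqrt 2 * y $ k) \<in> \<int>" for k
    by (rule Ints_mult; rule D4_roots_norm_coord(2); fact assms)
  ultimately have "2 * (x \<bullet> y) \<in> \<int>" by (simp only: Ints_sum)
  then obtain m where "2 * (x \<bullet> y) = of_int m" by (elim Ints_cases)
  with \<open>x \<bullet> y < 1\<close> have "of_int m < (2::real)" by linarith
  then have "m \<le> 1" by linarith
  then show ?thesis using \<open>2 * (x \<bullet> y) = of_int m\<close> by linarith
qed

lemma D4_roots_memI:
  assumes "s\<^sup>2 = 1" "t\<^sup>2 = 1" "i \<noteq> j"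
  shows "(of_int s *\<^sub>R axis i 1 + of_int t *\<^sub>R axis j 1) /\<^sub>R sqrt 2 \<in> D4_roots"
  using assms unfolding D4_roots_eq power2_eq_1_iff
  by (intro CollectI exI[of _ "of_int s"] exI[of _ "of_int t"] exI[of _ i] exI[of _ j]) auto

lemma sumsq4_eq_2_cases:
  fixes p q r s :: int
  assumes "p\<^sup>2 + q\<^sup>2 + r\<^sup>2 + s\<^sup>2 = 2"
  shows "\<bar>p\<bar> \<le> 1" "\<bar>q\<bar> \<le> 1" "\<bar>r\<bar> \<le> 1" "\<bar>s\<bar> \<le> 1"
proof -
  have *: "\<bar>x\<bar> \<le> 1" if "x\<^sup>2 \<le> 2" for x :: int
  proof (rule ccontr)
    assume "\<not> ?thesis"
    then have "2\<^sup>2 \<le> \<bar>x\<bar>\<^sup>2" by (intro power_mono) auto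
    then show False using that by simp
  qed
  have "p\<^sup>2 \<ge> 0" "q\<^sup>2 \<ge> 0" "r\<^sup>2 \<ge> 0" "s\<^sup>2 \<ge> 0" by simp_all
  then show "\<bar>p\<bar> \<le> 1" "\<bar>q\<bar> \<le> 1" "\<bar>r\<bar> \<le> 1" "\<bar>s\<bar> \<le> 1" using assms by (intro *; linarith)+
qed

lemma root_frame_D4_roots:
  "root_frame D4_roots (axis 1 1) (axis 2 1) (axis 3 1) (axis 4 1)"
proof -
  have "(of_int p *\<^sub>R axis 1 1 + of_int q *\<^sub>R axis 2 1 + of_int r *\<^sub>R axis 3 1 + of_int s *\<^sub>R axis 4 1) /\<^sub>R sqrt 2 \<in> D4_roots"
    if sq: "p\<^sup>2 + q\<^sup>2 + r\<^sup>2 + s\<^sup>2 = 2" for p q r s :: int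
  proof -
    have *: "x = 0 \<or> x\<^sup>2 = 1" if "\<bar>x\<bar> \<le> 1" for x :: int
      using that by (auto simp: power2_eq_1_iff)
    \<comment> \<open>Of the sixteen cases only the six with exactly two nonzero coefficients are
      compatible with \<open>sq\<close>.\<close>
    from *[OF sumsq4_eq_2_cases(1)[OF sq]] *[OF sumsq4_eq_2_cases(2)[OF sq]]
      *[OF sumsq4_eq_2_cases(3)[OF sq]] *[OF sumsq4_eq_2_cases(4)[OF sq]] sq
    show ?thesis
      using D4_roots_memI[of p q 1 2] D4_roots_memI[of p r 1 3] D4_roots_memI[of p s 1 4]
        D4_roots_memI[of q r 2 3] D4_roots_memI[of q s 2 4] D4_roots_memI[of r s 3 4]
      by (elim disjE) simp_all
  qed
  moreover have "v = (v \<bullet> axis 1 1) *\<^sub>R axis 1 1 + (v \<bullet> axis 2 1) *\<^sub>R axis 2 1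
      + (v \<bullet> axis 3 1) *\<^sub>R axis 3 1 + (v \<bullet> axis 4 1) *\<^sub>R axis 4 1" for v :: "real^4"
    by (simp add: vec_eq_iff forall_4 inner_axis) (simp add: axis_def)
  ultimately show ?thesis unfolding root_frame_def by (simp add: inner_axis_axis)
qed

lemma root_frame_image:
  assumes "root_frame R a b c d" "orthogonal_transformation f"
  shows "root_frame (f ` R) (f a) (f b) (f c) (f d)"
proof -
  have lin: "linear f" and inner: "f x \<bullet> f y = x \<bullet> y" for x y
    using assms(2) by (auto simp: orthogonal_transformation_def)
  have "v = (v \<bullet> f a) *\<^sub>R f a + (v \<bullet> f b) *\<^sub>R f b + (v \<bullet> f c) *\<^sub>R f c + (v \<bullet> f d) *\<^sub>R f d" for v
  proof -
    obtain u where v: "v = f u"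
      using orthogonal_transformation_surj[OF assms(2)] by (metis surjD)
    have "f u = f ((u \<bullet> a) *\<^sub>R a + (u \<bullet> b) *\<^sub>R b + (u \<bullet> c) *\<^sub>R c + (u \<bullet> d) *\<^sub>R d)"
      using root_frame_expansion[OF assms(1), of u] by simp
    then show ?thesis unfolding v inner by (simp only: linear_add[OF lin] linear_scale[OF lin])
  qed
  moreover have "(of_int p *\<^sub>R f a + of_int q *\<^sub>R f b + of_int r *\<^sub>R f c + of_int s *\<^sub>R f d) /\<^sub>R sqrt 2 \<in> f ` R"
    if "p\<^sup>2 + q\<^sup>2 + r\<^sup>2 + s\<^sup>2 = 2" for p q r s :: int
    using imageI[OF root_frame_root[OF assms(1) that], of f]
    by (simp add: linear_add[OF lin] linear_scale[OF lin])
  ultimately show ?thesis using assms(1) unfolding root_frame_def by (simp add: inner)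
qed

text \<open>The map \<open>g\<close> matches the roots with the integer quadruples of squared length
  2, whose entries lie in \<open>{-1, 0, 1}\<close> and can be enumerated by evaluation. Scaled
  coordinates recover the integers, which gives injectivity; integrality and unit norm of a root
  give surjectivity.\<close>

lemma card_D4_roots: "card D4_roots = 24"
proof -
  define S :: "(int \<times> int \<times> int \<times> int) set" where
    "S = {(p, q, r, s). p\<^sup>2 + q\<^sup>2 + r\<^sup>2 + s\<^sup>2 = 2}"
  define g :: "int \<times> int \<times> int \<times> int \<Rightarrow> real^4" where
    "g = (\<lambda>(p, q, r, s). (of_int p *\<^sub>R axis 1 1 + of_int q *\<^sub>R axis 2 1
            + of_int r *\<^sub>R axis 3 1 + of_int s *\<^sub>R axis 4 1) /\<^sub>R sqrt 2)"
  let ?l = "[-1, 0, 1 :: int]"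
  have coord: "sqrt 2 * g (p, q, r, s) $ 1 = p" "sqrt 2 * g (p, q, r, s) $ 2 = q"
    "sqrt 2 * g (p, q, r, s) $ 3 = r" "sqrt 2 * g (p, q, r, s) $ 4 = s" for p q r s
    by (simp_all add: g_def axis_def)
  have "S = set (filter (\<lambda>(p, q, r, s). p\<^sup>2 + q\<^sup>2 + r\<^sup>2 + s\<^sup>2 = 2)
      (List.product ?l (List.product ?l (List.product ?l ?l))))" (is "S = ?T")
  proof (intro equalityI subsetI)
    fix x assume "x \<in> S"
    moreover obtain p q r s where "x = (p, q, r, s)" by (metis prod.exhaust)
    ultimately have x: "x = (p, q, r, s)" and sq: "p\<^sup>2 + q\<^sup>2 + r\<^sup>2 + s\<^sup>2 = 2" by (auto simp: S_def)
    have "y \<in> set ?l" if "\<bar>y\<bar> \<le> 1" for y :: int using that by auto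
    then have "p \<in> set ?l" "q \<in> set ?l" "r \<in> set ?l" "s \<in> set ?l"
      using sumsq4_eq_2_cases[OF sq] by blast+
    then show "x \<in> ?T"
      using sq by (simp only: x set_filter set_product mem_Collect_eq mem_Times_iff prod.case fst_conv snd_conv)
  qed (auto simp: S_def)
  also have "card ?T = 24" by code_simp
  finally have "card S = 24" .
  moreover have "inj_on g S"
  proof (rule inj_onI)
    fix x y assume "g x = g y"
    moreover obtain p q r s where x: "x = (p, q, r, s)" by (metis prod.exhaust)
    moreover obtain p' q' r' s' where y: "y = (p', q', r', s')" by (metis prod.exhaust)
    ultimately show "x = y"
      using coord[of p q r s] coord[of p' q' r' s'] by (metis of_int_eq_iff)
  qed
  moreover have "g ` S = D4_roots"
  proof (intro equalityI subsetI)
    fix x assume "x \<in> g ` S"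
    then show "x \<in> D4_roots"
      using root_frame_root[OF root_frame_D4_roots] by (auto simp: S_def g_def)
  next
    fix x assume x: "x \<in> D4_roots"
    obtain m :: "4 \<Rightarrow> int" where m: "sqrt 2 * x $ k = of_int (m k)" for k
      using D4_roots_norm_coord(2)[OF x] unfolding Ints_def image_iff by metis
    have "x \<bullet> axis k 1 = x $ k" for k by (simp add: inner_axis)
    then have "real_of_int ((m 1)\<^sup>2 + (m 2)\<^sup>2 + (m 3)\<^sup>2 + (m 4)\<^sup>2) = 2"
      using root_frame_sumsq[OF root_frame_D4_roots D4_roots_norm_coord(1)[OF x]] by (simp add: m)
    then have "(m 1, m 2, m 3, m 4) \<in> S" unfolding S_def by (simp flip: of_int_power of_int_add)
    moreover have "sqrt 2 * g (m 1, m 2, m 3, m 4) $ k = sqrt 2 * x $ k" for k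
      using exhaust_4[of k] coord m by auto
    then have "x = g (m 1, m 2, m 3, m 4)" by (simp add: vec_eq_iff)
    ultimately show "x \<in> g ` S" by blast
  qed
  ultimately show ?thesis by (metis card_image)
qed

text \<open>An orthogonal map is injective and preserves inner products, so everything carries over
  from \<open>D4_roots\<close>. The final argument uses only these facts about
  \<open>R\<close>.\<close>

lemma root_system_facts:
  assumes "root_system R"
  shows "card R = 24" "\<And>x. x \<in> R \<Longrightarrow> norm x = 1"
    "\<And>x y. x \<in> R \<Longrightarrow> y \<in> R \<Longrightarrow> x \<noteq> y \<Longrightarrow> x \<bullet> y \<le> 1/2"
    "\<exists>a b c d. root_frame R a b c d"
proof -
  obtain f where f: "orthogonal_transformation f" and R: "R = f ` D4_roots"
    using assms by (auto simp: root_system_def)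
  show "card R = 24"
    unfolding R using card_image[of f D4_roots] orthogonal_transformation_inj[OF f] card_D4_roots
    by (metis inj_on_subset subset_UNIV)
  show "norm x = 1" if "x \<in> R" for x
    using that f D4_roots_norm_coord(1) by (auto simp: R orthogonal_transformation_norm)
  show "x \<bullet> y \<le> 1/2" if "x \<in> R" "y \<in> R" "x \<noteq> y" for x y
    using that f D4_roots_inner_le_half by (fastforce simp: R orthogonal_transformation_def)
  show "\<exists>a b c d. root_frame R a b c d"
    using root_frame_image[OF root_frame_D4_roots f] R by blast
qed

section \<open>Counting the omitted roots\<close>

lemma root_frame_triple_card:
  assumes "root_frame R a b c d"
  shows "card {(a + b) /\<^sub>R sqrt 2, (a + c) /\<^sub>R sqrt 2, (b + c) /\<^sub>R sqrt 2} = 3"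
proof -
  have "b \<noteq> c" "a \<noteq> c" "a \<noteq> b" using assms by (auto simp: root_frame_def)
  then show ?thesis by simp
qed

theorem corollary7p57:
  fixes W R :: "(real^4) set"
  assumes "contact_configuration W"
    and "card W = 23"
    and "cell_circumradius W < 2"
    and "root_system R"
  shows "card (W \<inter> R) \<le> 20"
proof (rule ccontr)
  assume "\<not> ?thesis"
  then have k: "card (W \<inter> R) \<ge> 21" by simp
  have finW: "finite W" and normW: "\<And>w. w \<in> W \<Longrightarrow> norm w = 1"
    and sepW: "\<And>w w'. w \<in> W \<Longrightarrow> w' \<in> W \<Longrightarrow> w \<noteq> w' \<Longrightarrow> w \<bullet> w' \<le> 1/2"
    using assms(1) by (auto simp: contact_configuration_def)
  note R = root_system_facts[OF assms(4)]
  have finR: "finite R" using R(1) by (metis card.infinite zero_neq_numeral)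
  have cards: "card (W - R) + card (W \<inter> R) = 23" "card (R - W) + card (W \<inter> R) = 24"
    using card_Int_Diff[OF finW, of R] card_Int_Diff[OF finR, of W] assms(2) R(1)
    by (simp_all add: Int_commute)
  \<comment> \<open>Since \<open>w\<close> is not a root it differs from \<open>r\<close>, so
    \<open>r \<in> W\<close> would violate the separation in \<open>W\<close>.\<close>
  have missing: "r \<in> R - W" if "w \<in> W - R" "r \<in> R" "w \<bullet> r > 1/2" for w r
    using that sepW[of w r] by fastforce
  obtain a b c d where fr: "root_frame R a b c d" using R(4) by blast
  \<comment> \<open>The frame depends on \<open>w\<close>, but its triple is always the whole of
    \<open>R - W\<close>. Stating the lower bound over \<open>R - W\<close> lets it be used with the
    frame of another direction.\<close>
  have triple: "\<exists>a b c d. root_frame R a b c d \<and>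
      R - W = {(a + b) /\<^sub>R sqrt 2, (a + c) /\<^sub>R sqrt 2, (b + c) /\<^sub>R sqrt 2} \<and> (\<forall>r\<in>R - W. w \<bullet> r > 1/2)"
    if w: "w \<in> W - R" for w
  proof -
    obtain a' b' c' d' where fr': "root_frame R a' b' c' d'"
      and gt: "w \<bullet> ((a' + b') /\<^sub>R sqrt 2) > 1/2" "w \<bullet> ((a' + c') /\<^sub>R sqrt 2) > 1/2"
        "w \<bullet> ((b' + c') /\<^sub>R sqrt 2) > 1/2"
      using non_root_frame[OF fr] w normW by (metis DiffD1 DiffD2)
    let ?T = "{(a' + b') /\<^sub>R sqrt 2, (a' + c') /\<^sub>R sqrt 2, (b' + c') /\<^sub>R sqrt 2}"
    have "?T \<subseteq> R"
      using root_frame_pair_root[OF fr', of 1 1 a' b'] root_frame_pair_root[OF fr', of 1 1 a' c']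
        root_frame_pair_root[OF fr', of 1 1 b' c'] by simp
    then have "?T \<subseteq> R - W" using missing[OF w] gt by blast
    \<comment> \<open>At least 21 of the 24 roots lie in \<open>W\<close>, so at most three are
      omitted and the triple exhausts them.\<close>
    moreover have "card (R - W) \<le> card ?T"
      using cards k unfolding root_frame_triple_card[OF fr'] by simp
    ultimately have "R - W = ?T" using card_seteq[of "R - W" ?T] finR by simp
    then show ?thesis using fr' gt
      by (intro exI[of _ a'] exI[of _ b'] exI[of _ c'] exI[of _ d']) simp
  qed
  show False
  proof (cases "W - R = {}")
    case True
    then have "card (W - R) = 0" by (simp only: card.empty)
    then have "card (R - W) = 1" using cards by linarith
    then obtain r where r: "R - W = {r}" by (rule card_1_singletonE)
    \<comment> \<open>Every \<open>w\<close> is a root other than \<open>r\<close>, so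
      \<open>r \<bullet> w \<le> 1/2\<close>; the cell then contains a point of norm 2.\<close>
    have "(2 *\<^sub>R r) \<bullet> w \<le> 1" if "w \<in> W" for w
    proof -
      have "r \<in> R" "w \<in> R" "r \<noteq> w" using r True that by auto
      then show ?thesis using R(3)[of r w] by simp
    qed
    then have "2 *\<^sub>R r \<in> cell W" by (simp add: cell_def)
    then have "ereal (norm (2 *\<^sub>R r)) \<le> cell_circumradius W"
      unfolding cell_circumradius_def by (rule SUP_upper)
    moreover have "norm r = 1" by (rule R(2)) (use r in auto)
    ultimately have "2 \<le> cell_circumradius W" by simp
    then show False using assms(3) by simp
  next
    case False
    then obtain v where v: "v \<in> W - R" by blast
    obtain a' b' c' d' where fr': "root_frame R a' b' c' d'"
      and T: "R - W = {(a' + b') /\<^sub>R sqrt 2, (a' + c') /\<^sub>R sqrt 2, (b' + c') /\<^sub>R sqrt 2}"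
      using triple[OF v] by blast
    have "card (R - W) = 3" unfolding T by (rule root_frame_triple_card[OF fr'])
    then have "card (W - R) = 2" using cards by simp
    then obtain v' where v': "v' \<in> W - R" "v' \<noteq> v" by (metis card_2_iff')
    \<comment> \<open>For \<open>v'\<close> the bound comes from its own frame, yet it concerns the
      same set \<open>R - W\<close>, which \<open>T\<close> describes in the frame of
      \<open>v\<close>.\<close>
    have gt: "w \<bullet> r > 1/2" if "w \<in> {v, v'}" "r \<in> R - W" for w r
      using triple that v v'(1) by blast
    have le: "w \<bullet> r \<le> 1/2" if "w \<in> {v, v'}" "r \<in> R" "r \<notin> R - W" for w r
      using missing that v v'(1) by (metis insertE linorder_not_le singletonD)
    have "v \<bullet> v' > 1/2"
      by (rule root_frame_inner_gt_half[OF fr', folded T]) (use gt le normW v v' in auto)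
    then show False using sepW[of v v'] v v' by auto
  qed
qed

end
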